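(* Let $G=(V,E)$ be a graph without isolated vertices of order $n\geq 2$ and let $t\geq 2$. Then $\lambda(M^t(G))=2^{t-1}(n+2)-2$ if and only if for every $S\subseteq V$ we have $|D_2(S)|\geq |S|$, where $D_2(S)=\{x\in V : \exists v\in S,\ d_G(x,v)>2\}$.
   Context: Graphs are finite, simple, undirected; $d_G(x,v)$ is the distance in $G$ (infinite if $x,v$ lie in different components). An $L(2,1)$-labeling of $G$ is a map $f:V\to\{0,1,2,\dots\}$ with $|f(x)-f(y)|\ge 2$ if $d_G(x,y)=1$ and $|f(x)-f(y)|\ge1$ if $d_G(x,y)=2$; $\lambda(G)$ is the minimum over such $f$ of the largest label. For $V=\{v_1,\dots,v_n\}$, $M(G)$ has vertex set $V\cup\{v_1',\dots,v_n'\}\cup\{u\}$ and edge set $E\cup\{v_iv_j' : v_iv_j\in E\}\cup\{v_i'u: 1\le i\le n\}$; $M^0(G)=G$, $M^t(G)=M(M^{t-1}(G))$. *)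

theory Defs
  imports "Graph_Theory.Graph_Theory"
begin

text \<open>
  A finite simple undirected graph is a \<open>pair_graph\<close>: an edge \<open>vw\<close> is
  represented by the two arcs \<open>(v, w)\<close> and \<open>(w, v)\<close>.
\<close>

definition graph_dist :: "'a pair_pre_digraph \<Rightarrow> 'a \<Rightarrow> 'a \<Rightarrow> ereal" where
  "graph_dist G x y = wf_digraph.\<mu> (with_proj G) (\<lambda>_. 1) x y"

definition L21_labeling :: "'a pair_pre_digraph \<Rightarrow> ('a \<Rightarrow> nat) \<Rightarrow> bool" where
  "L21_labeling G f \<longleftrightarrow>
    (\<forall>x\<in>pverts G. \<forall>y\<in>pverts G.
      (graph_dist G x y = 1 \<longrightarrow> \<bar>int (f x) - int (f y)\<bar> \<ge> 2) \<and>
      (graph_dist G x y = 2 \<longrightarrow> \<bar>int (f x) - int (f y)\<bar> \<ge> 1))"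

definition L21_number :: "'a pair_pre_digraph \<Rightarrow> nat" where
  "L21_number G = (LEAST k. \<exists>f. L21_labeling G f \<and> k = Max (f ` pverts G))"

text \<open>
  The Mycielski construction enlarges the vertex set, so the vertices of all iterates are
  taken from one recursive type: \<open>Base v\<close> is a vertex of the initial graph, and, for a vertex
  \<open>x\<close> of a graph \<open>H\<close>, \<open>Keep x\<close> and \<open>Shadow x\<close> are the vertices \<open>x\<close> and \<open>x'\<close> of \<open>M(H)\<close>.
\<close>

datatype 'a mvertex = Base 'a | Keep "'a mvertex" | Shadow "'a mvertex" | Apex

definition mycielski :: "'a mvertex pair_pre_digraph \<Rightarrow> 'a mvertex pair_pre_digraph" where
  "mycielski G =
    \<lparr> pverts = Keep ` pverts G \<union> Shadow ` pverts G \<union> {Apex},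
      parcs =
        {(Keep x, Keep y) | x y. (x, y) \<in> parcs G} \<union>
        {(Keep x, Shadow y) | x y. (x, y) \<in> parcs G} \<union>
        {(Shadow y, Keep x) | x y. (x, y) \<in> parcs G} \<union>
        {(Shadow x, Apex) | x. x \<in> pverts G} \<union>
        {(Apex, Shadow x) | x. x \<in> pverts G} \<rparr>"

definition base_graph :: "'a pair_pre_digraph \<Rightarrow> 'a mvertex pair_pre_digraph" where
  "base_graph G = \<lparr> pverts = Base ` pverts G, parcs = map_prod Base Base ` parcs G \<rparr>"

definition mycielski_iter :: "nat \<Rightarrow> 'a pair_pre_digraph \<Rightarrow> 'a mvertex pair_pre_digraph" where
  "mycielski_iter t G = (mycielski ^^ t) (base_graph G)"

definition D2 :: "'a pair_pre_digraph \<Rightarrow> 'a set \<Rightarrow> 'a set" where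
  "D2 G S = {x \<in> pverts G. \<exists>v\<in>S. graph_dist G x v > 2}"

text \<open>
  The defining equation of \<open>wf_digraph.\<mu>\<close> is only available for well-formed graphs; the
  following facts provide this for all iterates.
\<close>

lemma pair_graph_base_graph:
  assumes "pair_graph G"
  shows "pair_graph (base_graph G)"
proof -
  interpret pair_graph G by fact
  show ?thesis
  proof unfold_locales
    show "symmetric (with_proj (base_graph G))"
      using pair_sym_arcs by (force simp: base_graph_def symmetric_def sym_def)
  qed (auto simp: base_graph_def dest: wellformed' no_loops)
qed

lemma pair_graph_mycielski:
  assumes "pair_graph G"
  shows "pair_graph (mycielski G)"
proof -
  interpret pair_graph G by fact
  have fin: "finite (pverts (mycielski G))"
    by (simp add: mycielski_def)
  have sub: "parcs (mycielski G) \<subseteq> pverts (mycielski G) \<times> pverts (mycielski G)"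
    by (auto simp: mycielski_def dest: wellformed')
  have S: "(y, x) \<in> parcs G" if "(x, y) \<in> parcs G" for x y
    using pair_sym_arcs that by (auto simp: symmetric_def dest: symD)
  show ?thesis
  proof unfold_locales
    show "finite (parcs (mycielski G))"
      using fin sub finite_subset by blast
    show "symmetric (with_proj (mycielski G))"
      by (auto simp: mycielski_def symmetric_def sym_def intro: S)
    show "fst e \<noteq> snd e" if "e \<in> parcs (mycielski G)" for e
      using that by (auto simp: mycielski_def dest: no_loops)
  qed (use fin sub in auto)
qed

lemma pair_graph_mycielski_iter:
  assumes "pair_graph G"
  shows "pair_graph (mycielski_iter t G)"
  unfolding mycielski_iter_def
  by (induction t) (simp_all add: assms pair_graph_base_graph pair_graph_mycielski)

end

theory Submission
  imports Defs "HOL-Combinatorics.Cycles"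
begin

text \<open>
  Call two vertices near if their distance is at most 2. In \<open>M(H)\<close> the shadows are pairwise near
  and the apex is near everything; hence all shadows of \<open>M\<^sup>t(G)\<close> together with all copies of apexes
  need \<open>2\<^sup>t\<^sup>-\<^sup>1(n + 2) - 1\<close> distinct labels. If no more labels are used, the iterated shadow of
  each vertex \<open>v\<close> below the top level shares its label with the top shadow of some \<open>g v\<close> that is
  not near \<open>v\<close>, and \<open>g\<close> is injective.

  Conversely, Hall's theorem turns the condition into a permutation \<open>\<pi>\<close> of \<open>V\<close> with \<open>v\<close> never near
  \<open>\<pi> v\<close>, and even cycles of \<open>\<pi>\<close> may be cut into transpositions. For \<open>t = 2\<close> the classes
  \<open>Q\<^sub>v = {v, (\<pi> v)''}\<close> (the vertex \<open>\<pi> v\<close> shadowed at both levels) and \<open>R\<^sub>v\<close> (\<open>v\<close> shadowed at the lower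
  and \<open>\<pi> v\<close> at the upper level only) are ordered without conflicts between neighbours, cycle by
  cycle: a path ending in \<open>R\<^sub>a\<close> continues into an odd cycle at a vertex \<open>v\<close> adjacent to neither \<open>a\<close>
  nor \<open>\<pi> a\<close> as \<open>Q\<^sub>v, R\<^sub>v, Q\<^bsub>\<pi> v\<^esub>, R\<^bsub>\<pi> v\<^esub>, \<dots>\<close>, and into a transposition \<open>(b b*)\<close> as
  \<open>R\<^sub>b, Q\<^sub>b, Q\<^sub>b\<^sub>*, R\<^sub>b\<^sub>*\<close> or with \<open>b\<close>, \<open>b*\<close> exchanged. The step from \<open>t\<close> to \<open>t + 1\<close> splits every
  label into two.
\<close>

subsection \<open>Distances and labelings\<close>

text \<open>Distance at most 2 expressed by arcs alone (see \<open>graph_dist_le_2_iff\<close>), so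
  that nearness in a Mycielski graph becomes a finite case analysis instead of a statement about
  walks.\<close>

definition near :: "'a pair_pre_digraph \<Rightarrow> 'a \<Rightarrow> 'a \<Rightarrow> bool" where
  "near G x y \<longleftrightarrow> x = y \<or> (x, y) \<in> parcs G \<or> (\<exists>z. (x, z) \<in> parcs G \<and> (z, y) \<in> parcs G)"

context pair_graph
begin

lemma arc_sym: "(x, y) \<in> parcs G \<Longrightarrow> (y, x) \<in> parcs G"
  using pair_sym_arcs by (auto simp: symmetric_def dest: symD)

lemma near_sym: "near G x y \<Longrightarrow> near G y x"
  by (auto simp: near_def intro: arc_sym)

lemma graph_dist_le_length:
  assumes "awalk x p y"
  shows "graph_dist G x y \<le> ereal (real (length p))"
proof -
  have "awalk_cost (\<lambda>_. 1) p = real (length p)"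
    by (induction p) auto
  then show ?thesis
    using min_cost_le_walk_cost[OF assms, of "\<lambda>_. 1"] by (simp add: graph_dist_def)
qed

text \<open>The distance is an infimum of walk costs, so a strict upper bound is met by an actual
  walk.\<close>

lemma graph_dist_less_imp_awalk:
  assumes "graph_dist G x y < ereal (real k)"
  obtains p where "awalk x p y" "length p < k"
proof -
  have cost: "awalk_cost (\<lambda>_. 1) p = real (length p)" for p :: "('a \<times> 'a) list"
    by (induction p) auto
  from assms obtain p where "awalk x p y" "ereal (awalk_cost (\<lambda>_. 1) p) < ereal (real k)"
    unfolding graph_dist_def \<mu>_def by (auto simp: INF_less_iff)
  then show ?thesis
    using that by (simp add: cost)
qed

lemma graph_dist_less_1_iff:
  assumes "x \<in> pverts G"
  shows "graph_dist G x y < 1 \<longleftrightarrow> x = y"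
proof
  assume "graph_dist G x y < 1"
  then show "x = y"
    using graph_dist_less_imp_awalk[of x y 1] by (auto simp: one_ereal_def awalk_Nil_iff)
next
  assume "x = y"
  then show "graph_dist G x y < 1"
    using graph_dist_le_length[of x "[]" y] assms
    by (auto simp: awalk_Nil_iff zero_ereal_def[symmetric] intro: order.strict_trans1)
qed

text \<open>Walk lengths are integers, so the two bounds agree. Both forms are kept because "exactly
  1" and "exactly 2" are later written as \<open>\<le>\<close> without \<open><\<close>.\<close>

lemma graph_dist_le_1_iff:
  assumes "x \<in> pverts G"
  shows "graph_dist G x y < 2 \<longleftrightarrow> x = y \<or> (x, y) \<in> parcs G"
    and "graph_dist G x y \<le> 1 \<longleftrightarrow> x = y \<or> (x, y) \<in> parcs G"
proof -
  have "x = y \<or> (x, y) \<in> parcs G" if less: "graph_dist G x y < 2"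
  proof -
    obtain p where p: "awalk x p y" "length p < 2"
      using graph_dist_less_imp_awalk[of x y 2] less by (auto simp: numeral_eq_ereal)
    then show ?thesis
      by (cases p) (auto simp: awalk_Nil_iff awalk_Cons_iff)
  qed
  moreover have "graph_dist G x y \<le> 1" if "x = y \<or> (x, y) \<in> parcs G"
    using that
  proof
    assume "x = y"
    then show ?thesis using graph_dist_less_1_iff[OF assms, of y] by auto
  next
    assume "(x, y) \<in> parcs G"
    then have "awalk x [(x, y)] y"
      by (auto simp: awalk_Nil_iff awalk_Cons_iff dest: wellformed')
    from graph_dist_le_length[OF this] show ?thesis by (simp add: one_ereal_def)
  qed
  moreover have "a < 2" if "a \<le> 1" for a :: ereal
    using that by (rule order.strict_trans1) simp
  ultimately show "graph_dist G x y < 2 \<longleftrightarrow> x = y \<or> (x, y) \<in> parcs G"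
    and "graph_dist G x y \<le> 1 \<longleftrightarrow> x = y \<or> (x, y) \<in> parcs G"
    by blast+
qed

lemma graph_dist_le_2_iff:
  assumes "x \<in> pverts G"
  shows "graph_dist G x y \<le> 2 \<longleftrightarrow> near G x y"
proof
  assume "graph_dist G x y \<le> 2"
  also have "(2::ereal) < 3" by simp
  finally obtain p where p: "awalk x p y" "length p < 3"
    using graph_dist_less_imp_awalk[of x y 3] by (auto simp: numeral_eq_ereal)
  then consider "p = []" | e where "p = [e]" | e e' where "p = [e, e']"
    \<comment> \<open>\<open>remdups_adj.cases\<close> only supplies the split into empty, singleton
      and longer lists.\<close>
    by (cases p rule: remdups_adj.cases; cases "tl (tl p)") auto
  then show "near G x y"
    using p(1) by cases (auto simp: near_def awalk_Nil_iff awalk_Cons_iff)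
next
  assume near: "near G x y"
  show "graph_dist G x y \<le> 2"
  proof (cases "x = y \<or> (x, y) \<in> parcs G")
    case True
    then have "graph_dist G x y < 2" using graph_dist_le_1_iff[OF assms] by blast
    then show ?thesis by simp
  next
    case False
    with near obtain z where "(x, z) \<in> parcs G" "(z, y) \<in> parcs G" by (auto simp: near_def)
    then have "awalk x [(x, z), (z, y)] y"
      by (auto simp: awalk_Nil_iff awalk_Cons_iff dest: wellformed')
    from graph_dist_le_length[OF this] show ?thesis by (simp add: numeral_eq_ereal)
  qed
qed

text \<open>The second clause may include adjacent vertices, since a gap of 2 already makes their
  labels different.\<close>

lemma L21_labeling_iff:
  "L21_labeling G f \<longleftrightarrow>
    (\<forall>x\<in>pverts G. \<forall>y\<in>pverts G.
      ((x, y) \<in> parcs G \<longrightarrow> \<bar>int (f x) - int (f y)\<bar> \<ge> 2) \<and>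
      (near G x y \<and> x \<noteq> y \<longrightarrow> f x \<noteq> f y))"
proof -
  have eq_iff: "a = b \<longleftrightarrow> a \<le> b \<and> \<not> a < b" for a b :: ereal
    by auto
  have 1: "graph_dist G x y = 1 \<longleftrightarrow> (x, y) \<in> parcs G" if "x \<in> pverts G" for x y
    unfolding eq_iff graph_dist_less_1_iff[OF that] graph_dist_le_1_iff[OF that]
    using no_loops' by blast
  have 2: "graph_dist G x y = 2 \<longleftrightarrow> near G x y \<and> x \<noteq> y \<and> (x, y) \<notin> parcs G"
    if "x \<in> pverts G" for x y
    unfolding eq_iff graph_dist_le_1_iff[OF that] graph_dist_le_2_iff[OF that] by blast
  have 3: "\<bar>int a - int b\<bar> \<ge> 1 \<longleftrightarrow> a \<noteq> b" for a b
    by auto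
  have 4: "\<bar>int a - int b\<bar> \<ge> 2 \<Longrightarrow> a \<noteq> b" for a b
    by auto
  show ?thesis
    unfolding L21_labeling_def 3
  proof (intro ball_cong refl)
    fix x y
    assume "x \<in> pverts G"
    from 1[OF this, of y] 2[OF this, of y] 4[of "f x" "f y"]
    show "((graph_dist G x y = 1 \<longrightarrow> 2 \<le> \<bar>int (f x) - int (f y)\<bar>) \<and>
        (graph_dist G x y = 2 \<longrightarrow> f x \<noteq> f y)) \<longleftrightarrow>
      (((x, y) \<in> parcs G \<longrightarrow> 2 \<le> \<bar>int (f x) - int (f y)\<bar>) \<and>
        (near G x y \<and> x \<noteq> y \<longrightarrow> f x \<noteq> f y))"
      by blast
  qed
qed

text \<open>Turns the condition of the theorem into Hall's condition for the sets of vertices not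
  near \<open>v\<close>.\<close>

lemma D2_eq: "D2 G S = (\<Union>v\<in>S. {x \<in> pverts G. \<not> near G v x})"
proof -
  have "graph_dist G x v > 2 \<longleftrightarrow> \<not> near G v x" if "x \<in> pverts G" for x v
    unfolding not_le[symmetric] graph_dist_le_2_iff[OF that] using near_sym by blast
  then show ?thesis by (auto simp: D2_def)
qed

text \<open>Doubling an injective numbering leaves gaps of at least 2 everywhere. Existence ensures
  that the \<open>LEAST\<close> in \<open>L21_number\<close> is attained.\<close>

lemma L21_labeling_exists: "\<exists>f. L21_labeling G f"
proof -
  obtain h :: "'a \<Rightarrow> nat" where h: "inj_on h (pverts G)"
    using finite_imp_inj_to_nat_seg[OF pair_finite_verts] by auto
  have "L21_labeling G (\<lambda>x. 2 * h x)"
    unfolding L21_labeling_iff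
  proof (intro ballI conjI impI)
    fix x y assume *: "x \<in> pverts G" "y \<in> pverts G" "(x, y) \<in> parcs G"
    then have "h x \<noteq> h y" using h no_loops' by (metis inj_onD)
    then show "2 \<le> \<bar>int (2 * h x) - int (2 * h y)\<bar>" by linarith
  next
    fix x y assume "x \<in> pverts G" "y \<in> pverts G" "near G x y \<and> x \<noteq> y"
    then show "2 * h x \<noteq> 2 * h y" using h by (auto dest: inj_onD)
  qed
  then show ?thesis by blast
qed

lemma L21_number_labeling:
  obtains f where "L21_labeling G f" "L21_number G = Max (f ` pverts G)"
proof -
  have "\<exists>k f. L21_labeling G f \<and> k = Max (f ` pverts G)"
    using L21_labeling_exists by blast
  then show ?thesis
    using that LeastI_ex[of "\<lambda>k. \<exists>f. L21_labeling G f \<and> k = Max (f ` pverts G)"]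
    unfolding L21_number_def by blast
qed

lemma L21_number_le:
  assumes "L21_labeling G f" "\<And>x. x \<in> pverts G \<Longrightarrow> f x \<le> k" "pverts G \<noteq> {}"
  shows "L21_number G \<le> k"
proof -
  have "L21_number G \<le> Max (f ` pverts G)"
    unfolding L21_number_def by (rule Least_le) (use assms in blast)
  also have "\<dots> \<le> k"
    using assms pair_finite_verts by simp
  finally show ?thesis .
qed

end

subsection \<open>Hall's theorem and cycle covers\<close>

text \<open>Induction on \<open>card I\<close>. If some nonempty proper subset \<open>J\<close> is
  tight, \<open>J\<close> is matched inside its union and the rest outside it; otherwise there is
  slack, and an arbitrary choice \<open>a\<close> for one \<open>i\<close> can be withdrawn from all
  other sets.\<close>

lemma hall_marriage:
  assumes "finite I" "\<And>i. i \<in> I \<Longrightarrow> finite (A i)"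
    and "\<And>J. J \<subseteq> I \<Longrightarrow> card J \<le> card (\<Union>i\<in>J. A i)"
  shows "\<exists>g. inj_on g I \<and> (\<forall>i\<in>I. g i \<in> A i)"
  using assms
proof (induction "card I" arbitrary: I A rule: less_induct)
  case less
  note fin = less.prems(1,2) and hall = less.prems(3)
  show ?case
  proof (cases "I = {}")
    case True
    then show ?thesis by simp
  next
    case False
    then obtain i where i: "i \<in> I" by blast
    show ?thesis
    proof (cases "\<exists>J. J \<subset> I \<and> J \<noteq> {} \<and> card (\<Union>i\<in>J. A i) = card J")
      case True
      then obtain J where J: "J \<subset> I" "J \<noteq> {}" "card (\<Union>i\<in>J. A i) = card J"
        by blast
      define U where "U = (\<Union>i\<in>J. A i)"
      have "card J < card I"
        using J fin by (simp add: psubset_card_mono)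
      then have "\<exists>g. inj_on g J \<and> (\<forall>i\<in>J. g i \<in> A i)"
        by (rule less.hyps) (use J fin hall in \<open>auto intro: finite_subset\<close>)
      then obtain g where g: "inj_on g J" "\<forall>i\<in>J. g i \<in> A i" by blast
      have "\<exists>h. inj_on h (I - J) \<and> (\<forall>i\<in>I - J. h i \<in> A i - U)"
      proof (rule less.hyps)
        show "card (I - J) < card I"
          using J fin by (intro psubset_card_mono) auto
        show "card K \<le> card (\<Union>i\<in>K. A i - U)" if K: "K \<subseteq> I - J" for K
        proof -
          have finJK: "finite J" "finite K"
            using J K fin by (auto intro: finite_subset)
          have "card J + card K = card (J \<union> K)"
            using K finJK by (subst card_Un_disjoint) auto
          also have "\<dots> \<le> card (\<Union>i\<in>J \<union> K. A i)"
            using J K by (intro hall) auto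
          also have "(\<Union>i\<in>J \<union> K. A i) = U \<union> (\<Union>i\<in>K. A i - U)"
            by (auto simp: U_def)
          also have "card \<dots> \<le> card U + card (\<Union>i\<in>K. A i - U)"
            by (rule card_Un_le)
          finally show ?thesis using J(3) by (simp add: U_def)
        qed
      qed (use fin in auto)
      then obtain h where h: "inj_on h (I - J)" "\<forall>i\<in>I - J. h i \<in> A i - U" by blast
      define k where "k j = (if j \<in> J then g j else h j)" for j
      have "inj_on k I"
      proof -
        have I: "I = J \<union> (I - J)" using J by auto
        have "k ` J \<subseteq> U" "k ` (I - J) \<inter> U = {}"
          using g h by (auto simp: k_def U_def)
        moreover have "inj_on k J" "inj_on k (I - J)"
          using g h by (auto simp: k_def inj_on_def)
        ultimately show ?thesis by (subst I, subst inj_on_Un) blast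
      qed
      moreover have "\<forall>j\<in>I. k j \<in> A j"
        using g h by (auto simp: k_def)
      ultimately show ?thesis by blast
    next
      case False
      then have strict: "card J < card (\<Union>i\<in>J. A i)" if "J \<subset> I" "J \<noteq> {}" for J
        using hall[of J] that by (metis le_neq_implies_less psubset_imp_subset)
      have "A i \<noteq> {}"
        using hall[of "{i}"] i by auto
      then obtain a where a: "a \<in> A i" by blast
      have "\<exists>h. inj_on h (I - {i}) \<and> (\<forall>j\<in>I - {i}. h j \<in> A j - {a})"
      proof (rule less.hyps)
        show "card (I - {i}) < card I"
          using i fin by (intro psubset_card_mono) auto
        show "card K \<le> card (\<Union>j\<in>K. A j - {a})" if K: "K \<subseteq> I - {i}" for K
        proof (cases "K = {}")
          case False
          have "card K < card (\<Union>j\<in>K. A j)"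
            using K i False by (intro strict) auto
          moreover have "card (\<Union>j\<in>K. A j) - 1 \<le> card ((\<Union>j\<in>K. A j) - {a})"
            by (metis Diff_empty Diff_insert0 card_Diff_singleton_if diff_le_self le_refl)
          moreover have "(\<Union>j\<in>K. A j - {a}) = (\<Union>j\<in>K. A j) - {a}" by auto
          ultimately show ?thesis by simp
        qed simp
      qed (use fin in auto)
      then obtain h where h: "inj_on h (I - {i})" "\<forall>j\<in>I - {i}. h j \<in> A j - {a}" by blast
      have "inj_on (h(i := a)) I"
        using h unfolding inj_on_def by auto
      moreover have "\<forall>j\<in>I. (h(i := a)) j \<in> A j"
        using h a by auto
      ultimately show ?thesis by blast
    qed
  qed
qed

text \<open>The equation \<open>map p c = rotate1 c\<close> says that \<open>p\<close> runs
  cyclically through \<open>c\<close>; a fixed point appears as a one-element list.\<close>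

lemma permutes_cycle_lists:
  assumes "p permutes S" "finite S"
  shows "\<exists>cs. distinct (concat cs) \<and> set (concat cs) = S \<and> (\<forall>c\<in>set cs. map p c = rotate1 c)"
  using cycle_decomposition[OF assms]
proof induction
  case empty
  show ?case by (rule exI[of _ "[]"]) simp
next
  case (comp I p c)
  then obtain cs where cs: "distinct (concat cs)" "set (concat cs) = I"
    "\<forall>c\<in>set cs. map p c = rotate1 c" by blast
  have p_outside: "p v = v" if "v \<notin> I" for v
    using comp.hyps(1) that by induction (auto simp: id_outside_supp)
  have "map (cycle_of_list c \<circ> p) c = rotate1 c"
  proof -
    have "map (cycle_of_list c \<circ> p) c = map (cycle_of_list c) c"
      using comp.hyps(3) p_outside by (intro map_cong) (auto simp: disjoint_iff)
    also have "\<dots> = rotate1 c"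
      using cyclic_rotation[OF comp.hyps(2), of 1] by simp
    finally show ?thesis .
  qed
  moreover have "map (cycle_of_list c \<circ> p) d = rotate1 d" if d: "d \<in> set cs" for d
  proof -
    have "set (map p d) \<subseteq> I" using cs d by auto
    then have "map (cycle_of_list c) (map p d) = map p d"
      using comp.hyps(3) by (intro map_idI id_outside_supp) auto
    then show ?thesis using cs(3) d by (metis map_map)
  qed
  ultimately have "\<forall>d\<in>set (c # cs). map (cycle_of_list c \<circ> p) d = rotate1 d"
    unfolding list.set by blast
  moreover have "distinct (concat (c # cs)) \<and> set (concat (c # cs)) = set c \<union> I"
    using comp.hyps cs by auto
  ultimately show ?case by blast
qed

lemma list_all2_rotate1_imp_successively:
  assumes "list_all2 F c (rotate1 c)"
  shows "successively F c"
  using assms by (auto simp: successively_conv_nth list_all2_conv_all_nth nth_rotate1)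
    (metis Suc_lessD mod_less)

text \<open>Entries are paired off, first with second, third with fourth and so on; symmetry of
  \<open>F\<close> closes each pair to a cycle of length 2.\<close>

lemma even_successively_split:
  assumes "even (length c)" "successively F c" "symp F"
  shows "\<exists>ds. concat ds = c \<and> (\<forall>d\<in>set ds. length d = 2 \<and> list_all2 F d (rotate1 d))"
  using assms
proof (induction c rule: induct_list012)
  case 1
  show ?case by (rule exI[of _ "[]"]) simp
next
  case (3 x y zs)
  then obtain ds where "concat ds = zs" "\<forall>d\<in>set ds. length d = 2 \<and> list_all2 F d (rotate1 d)"
    by (auto simp: successively_Cons)
  with 3 show ?case
    by (intro exI[of _ "[x, y] # ds"]) (auto dest: sympD)
qed simp

lemma permutes_odd_cycle_cover:
  assumes "p permutes S" "finite S" "\<And>v. v \<in> S \<Longrightarrow> F v (p v)" "symp F"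
  shows "\<exists>cs. distinct (concat cs) \<and> set (concat cs) = S \<and>
    (\<forall>c\<in>set cs. list_all2 F c (rotate1 c) \<and> (length c = 2 \<or> odd (length c)))"
proof -
  obtain cs where cs: "distinct (concat cs)" "set (concat cs) = S"
    "\<forall>c\<in>set cs. map p c = rotate1 c"
    using permutes_cycle_lists[OF assms(1,2)] by blast
  have "\<exists>ds. concat ds = c \<and>
      (\<forall>d\<in>set ds. list_all2 F d (rotate1 d) \<and> (length d = 2 \<or> odd (length d)))"
    if c: "c \<in> set cs" for c
  proof -
    have "set c \<subseteq> S" using cs(2) c by auto
    then have "list_all2 F c (map p c)"
      using assms(3) by (auto simp: list_all2_conv_all_nth subset_iff)
    then have all2: "list_all2 F c (rotate1 c)" using cs(3) c by simp
    show ?thesis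
    proof (cases "odd (length c)")
      case True
      with all2 show ?thesis by (intro exI[of _ "[c]"]) simp
    next
      case False
      then show ?thesis
        using even_successively_split[OF _ list_all2_rotate1_imp_successively[OF all2] assms(4)]
        by blast
    qed
  qed
  then obtain split where split: "\<And>c. c \<in> set cs \<Longrightarrow> concat (split c) = c"
    "\<And>c d. c \<in> set cs \<Longrightarrow> d \<in> set (split c) \<Longrightarrow>
      list_all2 F d (rotate1 d) \<and> (length d = 2 \<or> odd (length d))"
    by metis
  have concat_split: "concat (concat (map split cs)) = concat cs"
    using split(1) by (induction cs) auto
  show ?thesis
    by (rule exI[of _ "concat (map split cs)"]) (use concat_split cs split(2) in auto)
qed

text \<open>Once even cycles are cut, the lists need not be cycles of the original permutation; this
  provides a map that has them as its cycles.\<close>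

lemma cycle_lists_permutation:
  assumes "distinct (concat cs)"
  shows "\<exists>\<pi>. \<forall>c\<in>set cs. map \<pi> c = rotate1 c"
  using assms
proof (induction cs)
  case (Cons c cs)
  then obtain \<pi> where \<pi>: "\<forall>c\<in>set cs. map \<pi> c = rotate1 c" by auto
  define \<rho> where "\<rho> v = (if v \<in> set c then cycle_of_list c v else \<pi> v)" for v
  have "map \<rho> c = rotate1 c"
  proof -
    have "map \<rho> c = map (cycle_of_list c) c"
      by (simp add: \<rho>_def)
    also have "\<dots> = rotate1 c"
      using cyclic_rotation[of c 1] Cons.prems by simp
    finally show ?thesis .
  qed
  moreover have "map \<rho> d = rotate1 d" if "d \<in> set cs" for d
  proof -
    have "map \<rho> d = map \<pi> d"
      using Cons.prems that by (auto simp: \<rho>_def)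
    then show ?thesis using \<pi> that by simp
  qed
  ultimately show ?case by auto
qed simp

subsection \<open>Conflict-free orderings\<close>

text \<open>
  Given \<open>\<pi>\<close>, the vertices of \<open>M(M(G))\<close> other than the copies of apexes are put into classes
  sharing a label: \<open>Inl v\<close> stands for \<open>{Keep (Keep v), Shadow (Shadow (\<pi> v))}\<close> and \<open>Inr v\<close> for
  \<open>{Keep (Shadow v), Shadow (Keep (\<pi> v))}\<close>. Two classes are in conflict iff some arc joins them.
\<close>

fun conflict :: "'a pair_pre_digraph \<Rightarrow> ('a \<Rightarrow> 'a) \<Rightarrow> 'a + 'a \<Rightarrow> 'a + 'a \<Rightarrow> bool" where
  "conflict G \<pi> (Inl v) (Inl w) \<longleftrightarrow>
    (v, w) \<in> parcs G \<or> (v, \<pi> w) \<in> parcs G \<or> (w, \<pi> v) \<in> parcs G"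
| "conflict G \<pi> (Inl v) (Inr w) \<longleftrightarrow> (v, w) \<in> parcs G \<or> (v, \<pi> w) \<in> parcs G"
| "conflict G \<pi> (Inr v) (Inl w) \<longleftrightarrow> (w, v) \<in> parcs G \<or> (w, \<pi> v) \<in> parcs G"
| "conflict G \<pi> (Inr v) (Inr w) \<longleftrightarrow> (v, \<pi> w) \<in> parcs G \<or> (w, \<pi> v) \<in> parcs G"

definition zigzag :: "'a list \<Rightarrow> ('a + 'a) list" where
  "zigzag c = concat (map (\<lambda>v. [Inl v, Inr v]) c)"

lemma zigzag_simps [simp]: "zigzag [] = []" "zigzag (v # c) = Inl v # Inr v # zigzag c"
  by (simp_all add: zigzag_def)

lemma set_zigzag [simp]: "set (zigzag c) = Inl ` set c \<union> Inr ` set c"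
  by (induction c) auto

lemma distinct_zigzag: "distinct c \<Longrightarrow> distinct (zigzag c)"
  by (induction c) auto

lemma zigzag_eq_Nil_iff [simp]: "zigzag c = [] \<longleftrightarrow> c = []"
  by (cases c) auto

lemma hd_zigzag: "c \<noteq> [] \<Longrightarrow> hd (zigzag c) = Inl (hd c)"
  by (cases c) auto

lemma last_zigzag: "c \<noteq> [] \<Longrightarrow> last (zigzag c) = Inr (last c)"
  by (induction c) auto

lemma rotate1_imp_successively:
  assumes "map \<pi> c = rotate1 c"
  shows "successively (\<lambda>v w. w = \<pi> v) c"
  by (rule list_all2_rotate1_imp_successively)
    (simp add: assms[symmetric] list_all2_conv_all_nth)

context pair_graph
begin

text \<open>Along \<open>Inl v\<close>, \<open>Inr v\<close>, \<open>Inl (\<pi> v)\<close> a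
  conflict could only come from a loop or from an arc between \<open>v\<close> and
  \<open>\<pi> v\<close>, which are not near.\<close>

lemma successively_zigzag:
  assumes "successively (\<lambda>v w. w = \<pi> v) c" "\<And>v. v \<in> set c \<Longrightarrow> \<not> near G v (\<pi> v)"
  shows "successively (\<lambda>a b. \<not> conflict G \<pi> a b) (zigzag c)"
  using assms
  by (induction c rule: induct_list012) (auto simp: near_def dest: arc_sym no_loops')

text \<open>
  If every vertex of \<open>c\<close> were adjacent to \<open>a\<close> or to \<open>\<pi> a\<close>, these two kinds of vertices would
  alternate along the cycle, because consecutive vertices have no common neighbour.
\<close>

lemma odd_cycle_entry:
  assumes "map \<pi> c = rotate1 c" "odd (length c)"
    and far: "\<not> near G a (\<pi> a)" "\<And>v. v \<in> set c \<Longrightarrow> \<not> near G v (\<pi> v)"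
  shows "\<exists>v\<in>set c. (v, a) \<notin> parcs G \<and> (v, \<pi> a) \<notin> parcs G"
proof (rule ccontr)
  assume "\<not> ?thesis"
  then have all: "(v, a) \<in> parcs G \<or> (v, \<pi> a) \<in> parcs G" if "v \<in> set c" for v
    using that by blast
  define X where "X v \<longleftrightarrow> (v, a) \<in> parcs G" for v
  have "X (\<pi> v) \<longleftrightarrow> \<not> X v" if v: "v \<in> set c" for v
  proof -
    have "\<pi> v \<in> set c" using assms(1) v by (metis image_eqI list.set_map set_rotate1)
    then show ?thesis
      using all[OF v] all[of "\<pi> v"] far(1) far(2)[OF v] arc_sym
      by (auto simp: X_def near_def)
  qed
  then have "filter (X \<circ> \<pi>) c = filter (\<lambda>v. \<not> X v) c"
    by (intro filter_cong) auto
  \<comment> \<open>Rotation preserves the number of entries satisfying \<open>X\<close>, while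
    alternation equates it with the number of the others; so exactly half of \<open>c\<close>
    satisfies \<open>X\<close>.\<close>
  then have "length (filter X (map \<pi> c)) = length (filter (\<lambda>v. \<not> X v) c)"
    by (simp add: filter_map)
  moreover have "length (filter X (map \<pi> c)) = length (filter X c)"
    unfolding assms(1) by (cases c) auto
  ultimately have "length c = 2 * length (filter X c)"
    using sum_length_filter_compl[of X c] by simp
  with assms(2) show False by simp
qed

text \<open>Cycles are appended one at a time. Ending in some \<open>Inr\<close> is the invariant
  that lets the next cycle attach; starting in some \<open>Inl\<close> later keeps the
  \<open>Inr\<close> classes off the smallest class label.\<close>

lemma conflict_free_path_exists:
  assumes "cs \<noteq> []" "distinct (concat cs)"
    and "\<And>c. c \<in> set cs \<Longrightarrow> map \<pi> c = rotate1 c"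
    and "\<And>c. c \<in> set cs \<Longrightarrow> length c = 2 \<or> odd (length c)"
    and "\<And>v. v \<in> set (concat cs) \<Longrightarrow> \<not> near G v (\<pi> v)"
  shows "\<exists>p. distinct p \<and> set p = Inl ` set (concat cs) \<union> Inr ` set (concat cs) \<and>
    successively (\<lambda>a b. \<not> conflict G \<pi> a b) p \<and>
    (\<exists>v. hd p = Inl v) \<and> (\<exists>v\<in>set (concat cs). last p = Inr v)"
  using assms
proof (induction cs rule: rev_nonempty_induct)
  case (single c)
  then have c: "c \<noteq> []" by auto
  have "successively (\<lambda>a b. \<not> conflict G \<pi> a b) (zigzag c)"
    using single by (intro successively_zigzag rotate1_imp_successively) auto
  with single c show ?case
    by (intro exI[of _ "zigzag c"]) (auto simp: distinct_zigzag hd_zigzag last_zigzag)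
next
  case (snoc c cs)
  then obtain p where p: "distinct p" "set p = Inl ` set (concat cs) \<union> Inr ` set (concat cs)"
    "successively (\<lambda>a b. \<not> conflict G \<pi> a b) p" "\<exists>v. hd p = Inl v"
    "\<exists>v\<in>set (concat cs). last p = Inr v"
    by auto
  then obtain a where a: "a \<in> set (concat cs)" "last p = Inr a" by blast
  have "p \<noteq> []" using a(1) p(2) by force
  have far_a: "\<not> near G a (\<pi> a)" using snoc.prems(4) a by simp
  have far: "\<not> near G v (\<pi> v)" if "v \<in> set c" for v using snoc.prems(4) that by simp
  have c: "map \<pi> c = rotate1 c" "distinct c" "set c \<inter> set (concat cs) = {}"
    using snoc.prems by auto
  have "\<exists>q. distinct q \<and> set q = Inl ` set c \<union> Inr ` set c \<and> q \<noteq> [] \<and>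
    successively (\<lambda>a b. \<not> conflict G \<pi> a b) q \<and> \<not> conflict G \<pi> (Inr a) (hd q) \<and>
    (\<exists>v\<in>set c. last q = Inr v)"
  proof (cases "odd (length c)")
    case True
    obtain v where v: "v \<in> set c" "(v, a) \<notin> parcs G" "(v, \<pi> a) \<notin> parcs G"
      using odd_cycle_entry[OF c(1) True far_a far] by blast
    then obtain i where i: "i < length c" "c ! i = v" by (auto simp: in_set_conv_nth)
    \<comment> \<open>Rotating the cycle lets the zigzag start at the entry vertex
      \<open>v\<close>.\<close>
    define d where "d = rotate i c"
    have "c \<noteq> []" using v(1) by auto
    then have d: "d \<noteq> []" "hd d = v" "set d = set c" "distinct d"
      using i c(2) by (simp_all add: d_def hd_rotate_conv_nth)
    have "map \<pi> d = rotate1 d"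
      using c(1) by (simp add: d_def rotate_map[symmetric] rotate1_rotate_swap)
    then have "successively (\<lambda>a b. \<not> conflict G \<pi> a b) (zigzag d)"
      using far d(3) by (intro successively_zigzag rotate1_imp_successively) auto
    then show ?thesis
      using d v by (intro exI[of _ "zigzag d"])
        (auto simp: distinct_zigzag hd_zigzag last_zigzag simp flip: d(3))
  next
    case False
    then have "length c = 2" using snoc.prems(3)[of c] by simp
    then obtain b b' where bb: "c = [b, b']"
      by (auto simp: numeral_2_eq_2 length_Suc_conv)
    then have \<pi>: "\<pi> b = b'" "\<pi> b' = b" using c(1) by auto
    have ne: "b \<noteq> b'" using c(2) bb by simp
    have far_b: "\<not> near G b b'" using far[of b] bb \<pi> by simp
    have path: "successively (\<lambda>a b. \<not> conflict G \<pi> a b) [Inr x, Inl x, Inl y, Inr y]"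
      if "x = b \<and> y = b' \<or> x = b' \<and> y = b" for x y
      using that far_b \<pi> by (auto simp: near_def dest: arc_sym no_loops')
    \<comment> \<open>If both were conflicts, \<open>a\<close> and \<open>\<pi> a\<close> or else
      \<open>b\<close> and \<open>b'\<close> would have a common neighbour.\<close>
    have "\<not> conflict G \<pi> (Inr a) (Inr b) \<or> \<not> conflict G \<pi> (Inr a) (Inr b')"
      using far_a far_b arc_sym by (auto simp: near_def \<pi>)
    then show ?thesis
    proof
      assume "\<not> conflict G \<pi> (Inr a) (Inr b)"
      then show ?thesis
        using path[of b b'] ne bb by (intro exI[of _ "[Inr b, Inl b, Inl b', Inr b']"]) auto
    next
      assume "\<not> conflict G \<pi> (Inr a) (Inr b')"
      then show ?thesis
        using path[of b' b] ne bb by (intro exI[of _ "[Inr b', Inl b', Inl b, Inr b]"]) auto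
    qed
  qed
  then obtain q where q: "distinct q" "set q = Inl ` set c \<union> Inr ` set c" "q \<noteq> []"
    "successively (\<lambda>a b. \<not> conflict G \<pi> a b) q" "\<not> conflict G \<pi> (Inr a) (hd q)"
    "\<exists>v\<in>set c. last q = Inr v"
    by blast
  have "distinct (p @ q)"
    using p(1,2) q(1,2) c(3) by auto
  moreover have "successively (\<lambda>a b. \<not> conflict G \<pi> a b) (p @ q)"
    using p(3) q a by (simp add: successively_append_iff)
  ultimately show ?case
    using p q \<open>p \<noteq> []\<close> by (intro exI[of _ "p @ q"]) auto
qed

end

subsection \<open>Iterated Mycielski graphs\<close>

definition no_isolated :: "'a pair_pre_digraph \<Rightarrow> bool" where
  "no_isolated G \<longleftrightarrow> (\<forall>v\<in>pverts G. \<exists>w. (v, w) \<in> parcs G)"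

lemma pverts_mycielski_iff [simp]:
  "Keep x \<in> pverts (mycielski G) \<longleftrightarrow> x \<in> pverts G"
  "Shadow x \<in> pverts (mycielski G) \<longleftrightarrow> x \<in> pverts G"
  "Apex \<in> pverts (mycielski G)"
  "Base v \<notin> pverts (mycielski G)"
  by (auto simp: mycielski_def)

lemma parcs_mycielski_iff [simp]:
  "(Keep x, Keep y) \<in> parcs (mycielski G) \<longleftrightarrow> (x, y) \<in> parcs G"
  "(Keep x, Shadow y) \<in> parcs (mycielski G) \<longleftrightarrow> (x, y) \<in> parcs G"
  "(Shadow x, Keep y) \<in> parcs (mycielski G) \<longleftrightarrow> (y, x) \<in> parcs G"
  "(Shadow x, Shadow y) \<notin> parcs (mycielski G)"
  "(Shadow x, Apex) \<in> parcs (mycielski G) \<longleftrightarrow> x \<in> pverts G"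
  "(Apex, Shadow x) \<in> parcs (mycielski G) \<longleftrightarrow> x \<in> pverts G"
  "(Keep x, Apex) \<notin> parcs (mycielski G)"
  "(Apex, Keep x) \<notin> parcs (mycielski G)"
  "(Apex, Apex) \<notin> parcs (mycielski G)"
  by (auto simp: mycielski_def)

lemma pverts_mycielski_cases:
  assumes "x \<in> pverts (mycielski G)"
  obtains (Keep) y where "x = Keep y" "y \<in> pverts G"
  | (Shadow) y where "x = Shadow y" "y \<in> pverts G"
  | (Apex) "x = Apex"
  using assms by (auto simp: mycielski_def)

lemma parcs_mycielski_cases:
  assumes "(a, b) \<in> parcs (mycielski G)"
  obtains (KK) x y where "a = Keep x" "b = Keep y" "(x, y) \<in> parcs G"
  | (KS) x y where "a = Keep x" "b = Shadow y" "(x, y) \<in> parcs G"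
  | (SK) x y where "a = Shadow y" "b = Keep x" "(x, y) \<in> parcs G"
  | (SA) x where "a = Shadow x" "b = Apex" "x \<in> pverts G"
  | (AS) x where "a = Apex" "b = Shadow x" "x \<in> pverts G"
  using assms by (auto simp: mycielski_def)

lemma no_isolated_mycielski:
  assumes "no_isolated G" "pair_graph G" "pverts G \<noteq> {}"
  shows "no_isolated (mycielski G)"
  unfolding no_isolated_def
proof
  interpret pair_graph G by fact
  fix x
  assume "x \<in> pverts (mycielski G)"
  then show "\<exists>w. (x, w) \<in> parcs (mycielski G)"
  proof (cases rule: pverts_mycielski_cases)
    case (Keep y)
    then obtain w where "(y, w) \<in> parcs G" using assms(1) by (auto simp: no_isolated_def)
    then show ?thesis using Keep by (intro exI[of _ "Keep w"]) simp
  next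
    case (Shadow y)
    then show ?thesis by (intro exI[of _ Apex]) simp
  next
    case Apex
    obtain y where "y \<in> pverts G" using assms(3) by auto
    then show ?thesis using Apex by (intro exI[of _ "Shadow y"]) simp
  qed
qed

context pair_graph
begin

lemma near_self_via_neighbour:
  assumes "no_isolated G" "x \<in> pverts G"
  shows "\<exists>z. (x, z) \<in> parcs G \<and> (z, x) \<in> parcs G"
  using assms arc_sym unfolding no_isolated_def by blast

end

section \<open>Nearness in a single Mycielski step\<close>

lemma parcs_mycielski_Base [simp]:
  "(Base v, x) \<notin> parcs (mycielski G)" "(x, Base v) \<notin> parcs (mycielski G)"
  by (auto simp: mycielski_def)

lemma near_mycielski_unfold:
  "near (mycielski G) x y \<longleftrightarrow> x = y \<or> (x, y) \<in> parcs (mycielski G) \<or>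
    (\<exists>z. (x, Keep z) \<in> parcs (mycielski G) \<and> (Keep z, y) \<in> parcs (mycielski G)) \<or>
    (\<exists>z. (x, Shadow z) \<in> parcs (mycielski G) \<and> (Shadow z, y) \<in> parcs (mycielski G)) \<or>
    (x, Apex) \<in> parcs (mycielski G) \<and> (Apex, y) \<in> parcs (mycielski G)"
  unfolding near_def by (metis mvertex.exhaust parcs_mycielski_Base(1))

text \<open>A shadow as middle vertex can be replaced by its original, and the apex is adjacent to
  no \<open>Keep\<close> vertex, so no new short walks arise.\<close>

lemma near_mycielski_Keep_Keep:
  assumes "pair_graph G"
  shows "near (mycielski G) (Keep x) (Keep y) \<longleftrightarrow> near G x y"
proof -
  interpret pair_graph G by fact
  show ?thesis
    unfolding near_mycielski_unfold near_def[of G] using arc_sym by auto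
qed

text \<open>The end of a short walk may be replaced by its shadow. For \<open>x = y\<close> this
  takes a walk through a neighbour, which \<open>no_isolated\<close> provides.\<close>

lemma near_mycielski_Keep_Shadow:
  assumes "pair_graph G" "no_isolated G" "x \<in> pverts G"
  shows "near (mycielski G) (Keep x) (Shadow y) \<longleftrightarrow> near G x y"
    and "near (mycielski G) (Shadow y) (Keep x) \<longleftrightarrow> near G x y"
proof -
  interpret pair_graph G by fact
  interpret M: pair_graph "mycielski G" using assms(1) by (rule pair_graph_mycielski)
  show "near (mycielski G) (Keep x) (Shadow y) \<longleftrightarrow> near G x y"
    unfolding near_mycielski_unfold near_def[of G]
    using near_self_via_neighbour[OF assms(2,3)] by auto
  then show "near (mycielski G) (Shadow y) (Keep x) \<longleftrightarrow> near G x y"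
    using M.near_sym by blast
qed

lemma near_mycielski_Shadow_Shadow:
  assumes "x \<in> pverts G" "y \<in> pverts G"
  shows "near (mycielski G) (Shadow x) (Shadow y)"
  unfolding near_def using assms by (auto intro!: exI[of _ Apex])

lemma near_mycielski_Apex:
  assumes "pair_graph G" "no_isolated G" "x \<in> pverts (mycielski G)"
  shows "near (mycielski G) Apex x" "near (mycielski G) x Apex"
proof -
  interpret pair_graph G by fact
  interpret M: pair_graph "mycielski G" using assms(1) by (rule pair_graph_mycielski)
  show "near (mycielski G) Apex x"
    using assms(3)
  proof (cases rule: pverts_mycielski_cases)
    case (Keep y)
    then obtain z where "(y, z) \<in> parcs G" using assms(2) by (auto simp: no_isolated_def)
    with Keep show ?thesis
      by (auto simp: near_def arc_sym dest: wellformed' intro!: exI[of _ "Shadow z"])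
  qed (auto simp: near_def)
  then show "near (mycielski G) x Apex" by (rule M.near_sym)
qed

section \<open>Copies of apexes and the lower bound\<close>

fun apex_copies :: "nat \<Rightarrow> 'a mvertex set" where
  "apex_copies 0 = {}"
| "apex_copies (Suc t) = Keep ` apex_copies t \<union> Shadow ` apex_copies t \<union> {Apex}"

lemma finite_apex_copies: "finite (apex_copies t)"
  by (induction t) auto

lemma card_mycielski_set:
  assumes "finite A" "finite B"
  shows "card (Keep ` A \<union> Shadow ` B \<union> {Apex}) = card A + card B + 1"
proof -
  have "card (Keep ` A \<union> Shadow ` B) = card A + card B"
    using assms by (subst card_Un_disjoint) (auto simp: card_image inj_on_def)
  moreover have "Apex \<notin> Keep ` A \<union> Shadow ` B" by auto
  ultimately show ?thesis using assms by simp
qed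

lemma card_apex_copies: "card (apex_copies t :: 'a mvertex set) + 1 = 2 ^ t"
proof (induction t)
  case (Suc t)
  have "card (apex_copies (Suc t) :: 'a mvertex set) = 2 * card (apex_copies t :: 'a mvertex set) + 1"
    unfolding apex_copies.simps card_mycielski_set[OF finite_apex_copies finite_apex_copies] by simp
  with Suc show ?case by simp
qed simp

lemma mycielski_iter_Suc: "mycielski_iter (Suc t) G = mycielski (mycielski_iter t G)"
  by (simp add: mycielski_iter_def)

lemma mycielski_iter_0: "mycielski_iter 0 G = base_graph G"
  by (simp add: mycielski_iter_def)

lemma base_graph_simps [simp]:
  "pverts (base_graph G) = Base ` pverts G"
  "(Base v, Base w) \<in> parcs (base_graph G) \<longleftrightarrow> (v, w) \<in> parcs G"
  by (auto simp: base_graph_def)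

lemma near_base_graph: "near (base_graph G) (Base v) (Base w) \<longleftrightarrow> near G v w"
proof -
  have "(\<exists>z. (Base v, z) \<in> parcs (base_graph G) \<and> (z, Base w) \<in> parcs (base_graph G)) \<longleftrightarrow>
      (\<exists>z. (v, z) \<in> parcs G \<and> (z, w) \<in> parcs G)"
    by (auto simp: base_graph_def)
  then show ?thesis by (simp add: near_def)
qed

lemma pverts_mycielski_eq:
  "pverts (mycielski G) = Keep ` pverts G \<union> Shadow ` pverts G \<union> {Apex}"
  by (simp add: mycielski_def)

locale mycielski_tower = pair_graph G for G :: "'a pair_pre_digraph" +
  assumes no_isolated: "no_isolated G"
    and nonempty: "pverts G \<noteq> {}"
begin

abbreviation M where "M t \<equiv> mycielski_iter t G"

lemma pair_graph_M: "pair_graph (M t)"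
  by (rule pair_graph_mycielski_iter) unfold_locales

lemma finite_M: "finite (pverts (M t))"
  using pair_graph_M by (simp add: pair_graph_def pair_digraph_def pair_fin_digraph.pair_finite_verts)

lemma M_nonempty: "pverts (M t) \<noteq> {}"
  using nonempty by (cases t) (auto simp: mycielski_iter_0 mycielski_iter_Suc pverts_mycielski_eq)

lemma no_isolated_M: "no_isolated (M t)"
proof (induction t)
  case 0
  show ?case using no_isolated by (auto simp: mycielski_iter_0 no_isolated_def) (metis base_graph_simps(2))
next
  case (Suc t)
  then show ?case
    unfolding mycielski_iter_Suc
    by (rule no_isolated_mycielski) (rule pair_graph_M M_nonempty)+
qed

text \<open>With 1 added, the number of vertices exactly doubles in each step.\<close>

lemma card_M: "card (pverts (M t)) + 1 = 2 ^ t * (card (pverts G) + 1)"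
proof (induction t)
  case 0
  show ?case by (simp add: mycielski_iter_0 card_image inj_on_def)
next
  case (Suc t)
  then show ?case
    by (simp add: mycielski_iter_Suc pverts_mycielski_eq card_mycielski_set finite_M
        del: Un_insert_right)
qed

lemma apex_copies_subset: "apex_copies t \<subseteq> pverts (M t)"
  by (induction t) (auto simp: mycielski_iter_Suc)

text \<open>Being near every vertex passes from \<open>a\<close> to both \<open>Keep a\<close> and
  \<open>Shadow a\<close>, and each new apex has this property.\<close>

lemma near_apex_copies:
  assumes "a \<in> apex_copies t" "x \<in> pverts (M t)"
  shows "near (M t) a x"
  using assms
proof (induction t arbitrary: a x)
  case (Suc t)
  note near = near_mycielski_Keep_Keep[OF pair_graph_M]
    near_mycielski_Keep_Shadow[OF pair_graph_M no_isolated_M]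
    near_mycielski_Shadow_Shadow near_mycielski_Apex[OF pair_graph_M no_isolated_M]
  have sym: "near (M t) x y" if "near (M t) y x" for x y
    using pair_graph.near_sym[OF pair_graph_M that] .
  have sub: "b \<in> pverts (M t)" if "b \<in> apex_copies t" for b
    using that apex_copies_subset by blast
  have near': "near (M t) x b" if "b \<in> apex_copies t" "x \<in> pverts (M t)" for x b
    using Suc.IH[OF that] by (rule sym)
  from Suc.prems(2)[unfolded mycielski_iter_Suc] Suc.prems(1) Suc.IH show ?case
    unfolding mycielski_iter_Suc
    by (cases rule: pverts_mycielski_cases) (auto simp: near near' sub)
qed simp

text \<open>A set of vertices of \<open>M (Suc t)\<close>, not of \<open>M t\<close>. Its members
  are pairwise near and so need distinct labels; its size gives the lower bound.\<close>

definition top_clique :: "nat \<Rightarrow> 'a mvertex set" where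
  "top_clique t = Keep ` apex_copies t \<union> Shadow ` pverts (M t) \<union> {Apex}"

lemma card_top_clique: "card (top_clique t) + 1 = 2 ^ t * (card (pverts G) + 2)"
proof -
  have "card (top_clique t) = card (apex_copies t :: 'a mvertex set) + card (pverts (M t)) + 1"
    unfolding top_clique_def by (rule card_mycielski_set) (rule finite_apex_copies finite_M)+
  then show ?thesis
    using card_M[of t] card_apex_copies[of t, where ?'a = 'a] by (simp add: algebra_simps)
qed

lemma top_clique_subset: "top_clique t \<subseteq> pverts (M (Suc t))"
  using apex_copies_subset[of t] by (auto simp: top_clique_def mycielski_iter_Suc)

lemma near_top_clique:
  assumes "x \<in> top_clique t" "y \<in> top_clique t"
  shows "near (M (Suc t)) x y"
proof -
  have sub: "b \<in> pverts (M t)" if "b \<in> apex_copies t" for b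
    using that apex_copies_subset by blast
  show ?thesis
    using assms unfolding top_clique_def mycielski_iter_Suc
    by (auto simp: near_mycielski_Keep_Keep[OF pair_graph_M]
        near_mycielski_Keep_Shadow[OF pair_graph_M no_isolated_M]
        near_mycielski_Shadow_Shadow near_mycielski_Apex[OF pair_graph_M no_isolated_M]
        sub near_apex_copies)
qed

lemma inj_on_top_clique:
  assumes "L21_labeling (M (Suc t)) f"
  shows "inj_on f (top_clique t)"
  using assms near_top_clique top_clique_subset
  unfolding pair_graph.L21_labeling_iff[OF pair_graph_M] inj_on_def by blast

lemma top_clique_labels:
  assumes "L21_labeling (M (Suc t)) f"
  shows "f ` top_clique t \<subseteq> {..Max (f ` pverts (M (Suc t)))}"
    and "2 ^ t * (card (pverts G) + 2) - 2 \<le> Max (f ` pverts (M (Suc t)))"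
proof -
  show sub: "f ` top_clique t \<subseteq> {..Max (f ` pverts (M (Suc t)))}"
    using top_clique_subset finite_M by (auto intro!: Max_ge)
  have "card (top_clique t) = card (f ` top_clique t)"
    using inj_on_top_clique[OF assms] by (simp add: card_image)
  \<comment> \<open>Labels start at 0, hence the additional 1.\<close>
  also have "\<dots> \<le> Max (f ` pverts (M (Suc t))) + 1"
    using card_mono[OF _ sub] by simp
  finally show "2 ^ t * (card (pverts G) + 2) - 2 \<le> Max (f ` pverts (M (Suc t)))"
    using card_top_clique[of t] by linarith
qed

lemma L21_number_M_ge: "2 ^ t * (card (pverts G) + 2) - 2 \<le> L21_number (M (Suc t))"
proof -
  obtain f where "L21_labeling (M (Suc t)) f" "L21_number (M (Suc t)) = Max (f ` pverts (M (Suc t)))"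
    using pair_graph.L21_number_labeling[OF pair_graph_M] by blast
  then show ?thesis using top_clique_labels(2) by simp
qed

section \<open>From a tight labeling to an injection that avoids near vertices\<close>

abbreviation shadow_tower :: "nat \<Rightarrow> 'a \<Rightarrow> 'a mvertex" where
  "shadow_tower t v \<equiv> (Shadow ^^ t) (Base v)"

abbreviation keep_tower :: "nat \<Rightarrow> 'a \<Rightarrow> 'a mvertex" where
  "keep_tower t v \<equiv> (Keep ^^ t) (Base v)"

lemma shadow_tower_in_M: "v \<in> pverts G \<Longrightarrow> shadow_tower t v \<in> pverts (M t)"
  by (induction t) (auto simp: mycielski_iter_0 mycielski_iter_Suc)

text \<open>The levels are peeled off: a shadow is near every shadow and the apex, so only a
  \<open>Keep\<close> vertex can be far from it, and for that vertex the question moves to the level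
  below.\<close>

lemma not_near_shadow_tower:
  assumes "v \<in> pverts G" "y \<in> pverts (M t)" "\<not> near (M t) (shadow_tower t v) y"
  shows "\<exists>w\<in>pverts G. y = keep_tower t w \<and> \<not> near G v w"
  using assms(2,3)
proof (induction t arbitrary: y)
  case 0
  then show ?case by (auto simp: mycielski_iter_0 near_base_graph)
next
  case (Suc t)
  note sh = shadow_tower_in_M[OF assms(1), of t]
  have far: "\<not> near (mycielski (M t)) (Shadow (shadow_tower t v)) y"
    using Suc.prems(2) by (simp add: mycielski_iter_Suc)
  from Suc.prems(1)[unfolded mycielski_iter_Suc] show ?case
  proof (cases rule: pverts_mycielski_cases)
    case (Keep z)
    have "\<not> near (M t) (shadow_tower t v) z"
      using far Keep near_mycielski_Keep_Shadow(2)[OF pair_graph_M no_isolated_M Keep(2)]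
        pair_graph.near_sym[OF pair_graph_M] by blast
    with Suc.IH Keep show ?thesis by fastforce
  next
    case (Shadow z)
    then show ?thesis using far sh near_mycielski_Shadow_Shadow by blast
  next
    case Apex
    then show ?thesis
      using far sh near_mycielski_Apex(2)[OF pair_graph_M no_isolated_M] by simp
  qed
qed

lemma tight_labeling_imp_far_injection:
  assumes "L21_labeling (M (Suc t)) f" "t \<ge> 1"
    and "Max (f ` pverts (M (Suc t))) = 2 ^ t * (card (pverts G) + 2) - 2"
  shows "\<exists>g. inj_on g (pverts G) \<and> (\<forall>v\<in>pverts G. g v \<in> pverts G \<and> \<not> near G v (g v))"
proof -
  note lab = assms(1)[unfolded pair_graph.L21_labeling_iff[OF pair_graph_M]]
  \<comment> \<open>Tightness means that the clique uses every label in the range, so each vertex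
    outside it shares its label with a member.\<close>
  have "card (f ` top_clique t) = card {..Max (f ` pverts (M (Suc t)))}"
  proof -
    \<comment> \<open>Ensures that the truncated subtraction of 2 in the assumption is
      exact.\<close>
    have "1 * (card (pverts G) + 2) \<le> 2 ^ t * (card (pverts G) + 2)"
      by (rule mult_le_mono1) simp
    moreover have "card (f ` top_clique t) = card (top_clique t)"
      using inj_on_top_clique[OF assms(1)] by (simp add: card_image)
    ultimately show ?thesis using card_top_clique[of t] assms(3) by simp
  qed
  then have onto: "f ` top_clique t = {..Max (f ` pverts (M (Suc t)))}"
    using top_clique_labels(1)[OF assms(1)] by (intro card_subset_eq) auto
  have "\<exists>w\<in>pverts G. \<not> near G v w \<and> f (Keep (shadow_tower t v)) = f (Shadow (keep_tower t w))"
    if v: "v \<in> pverts G" for v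
  proof -
    let ?x = "Keep (shadow_tower t v)"
    have x: "?x \<in> pverts (M (Suc t))"
      using shadow_tower_in_M[OF v] by (simp add: mycielski_iter_Suc)
    then have "f ?x \<in> f ` top_clique t"
      unfolding onto using finite_M by simp
    then obtain y where y: "y \<in> top_clique t" "f ?x = f y" by auto
    have "shadow_tower t v \<notin> apex_copies t"
      by (induction t) auto
    then have "?x \<noteq> y"
      using y(1) by (auto simp: top_clique_def)
    then have far: "\<not> near (M (Suc t)) ?x y"
      using lab x y top_clique_subset by blast
    \<comment> \<open>The partner is no copy of an apex, since these are near everything; only a
      top-level shadow remains.\<close>
    have "\<exists>z\<in>pverts (M t). y = Shadow z"
    proof -
      have "\<not> near (M t) (shadow_tower t v) a" if "y = Keep a" for a
        using far that by (simp add: mycielski_iter_Suc near_mycielski_Keep_Keep[OF pair_graph_M])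
      moreover have "near (M t) (shadow_tower t v) a" if "a \<in> apex_copies t" for a
        using near_apex_copies[OF that shadow_tower_in_M[OF v]]
        by (rule pair_graph.near_sym[OF pair_graph_M])
      moreover have "y \<noteq> Apex"
        using far near_mycielski_Apex(2)[OF pair_graph_M no_isolated_M] x
        by (auto simp: mycielski_iter_Suc)
      ultimately show ?thesis using y(1) by (auto simp: top_clique_def)
    qed
    then obtain z where z: "z \<in> pverts (M t)" "y = Shadow z" by blast
    then have "\<not> near (M t) (shadow_tower t v) z"
      using far shadow_tower_in_M[OF v, of t]
      by (simp add: mycielski_iter_Suc near_mycielski_Keep_Shadow[OF pair_graph_M no_isolated_M])
    then obtain w where "w \<in> pverts G" "z = keep_tower t w" "\<not> near G v w"
      using not_near_shadow_tower[OF v z(1)] by blast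
    then show ?thesis using y z by blast
  qed
  then obtain g where g: "\<And>v. v \<in> pverts G \<Longrightarrow> g v \<in> pverts G \<and> \<not> near G v (g v) \<and>
      f (Keep (shadow_tower t v)) = f (Shadow (keep_tower t (g v)))"
    by metis
  have "inj_on g (pverts G)"
  proof (rule inj_onI)
    fix v w
    assume v: "v \<in> pverts G" and w: "w \<in> pverts G" and eq: "g v = g w"
    let ?x = "Keep (shadow_tower t v)" and ?y = "Keep (shadow_tower t w)"
    \<comment> \<open>Here \<open>t \<ge> 1\<close> matters: the outermost constructor of the towers
      is then \<open>Shadow\<close>, and shadows are pairwise near, so different towers cannot share
      a label.\<close>
    obtain s where s: "t = Suc s" using assms(2) by (cases t) auto
    have "near (M t) (shadow_tower t v) (shadow_tower t w)"
      using shadow_tower_in_M[OF v, of s] shadow_tower_in_M[OF w, of s]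
      by (simp add: s mycielski_iter_Suc near_mycielski_Shadow_Shadow)
    then have "near (M (Suc t)) ?x ?y"
      by (simp add: mycielski_iter_Suc near_mycielski_Keep_Keep[OF pair_graph_M])
    moreover have "f ?x = f ?y" using g v w eq by metis
    moreover have "?x \<in> pverts (M (Suc t))" "?y \<in> pverts (M (Suc t))"
      using shadow_tower_in_M[OF v] shadow_tower_in_M[OF w] by (simp_all add: mycielski_iter_Suc)
    ultimately have "?x = ?y" using lab by blast
    then show "v = w" by (induction t) auto
  qed
  with g show ?thesis by blast
qed

end

subsection \<open>Construction of optimal labelings\<close>

text \<open>
  The mark \<open>s\<close> distinguishes the at most two vertices with a common label \<open>i\<close>, so that in \<open>M(G)\<close>
  the label \<open>i\<close> can be split into \<open>2i + 1\<close> and \<open>2i + 2\<close>, with \<open>Keep x\<close> paired with \<open>Shadow y\<close> for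
  different \<open>x\<close>, \<open>y\<close> labelled \<open>i\<close>. As label \<open>0\<close> is used by unmarked vertices only, no
  shadow gets label \<open>1\<close> in \<open>M(G)\<close>, which frees label \<open>0\<close> for the new apex.
\<close>

definition split_labeling :: "'a pair_pre_digraph \<Rightarrow> ('a \<Rightarrow> nat) \<Rightarrow> ('a \<Rightarrow> bool) \<Rightarrow> nat \<Rightarrow> bool" where
  "split_labeling G f s k \<longleftrightarrow>
    (\<forall>x\<in>pverts G. \<forall>y\<in>pverts G.
      ((x, y) \<in> parcs G \<longrightarrow> \<bar>int (f x) - int (f y)\<bar> \<ge> 2) \<and>
      (x \<noteq> y \<and> f x = f y \<longrightarrow> \<not> near G x y \<and> s x \<noteq> s y)) \<and>
    (\<forall>x\<in>pverts G. f x \<le> k \<and> (f x = 0 \<longrightarrow> \<not> s x))"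

section \<open>Splitting every label in one further Mycielski step\<close>

lemma split_labeling_imp_L21_labeling:
  assumes "pair_graph G" "split_labeling G f s k"
  shows "L21_labeling G f"
  using assms(2) unfolding pair_graph.L21_labeling_iff[OF assms(1)] split_labeling_def by blast

lemma split_labeling_mycielski:
  assumes "pair_graph G" "no_isolated G" "split_labeling G f s k"
  shows "\<exists>f s. split_labeling (mycielski G) f s (2 * k + 2)"
proof -
  interpret pair_graph G by fact
  \<comment> \<open>The value at \<open>Base\<close> is a dummy, as no such vertex occurs in a
    Mycielski graph.\<close>
  define f' where "f' x = (case x of Base _ \<Rightarrow> 0 | Apex \<Rightarrow> 0
    | Keep y \<Rightarrow> 2 * f y + (if s y then 2 else 1)
    | Shadow y \<Rightarrow> 2 * f y + (if s y then 1 else 2))" for x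
  \<comment> \<open>A new label occurs on at most one \<open>Keep\<close> and one
    \<open>Shadow\<close> vertex, so marking the shadows separates them; label 0 belongs to the
    unmarked apex alone.\<close>
  define s' where "s' x = (case x of Shadow _ \<Rightarrow> True | _ \<Rightarrow> False)" for x :: "'a mvertex"
  have f'_simps: "f' Apex = 0" "f' (Keep y) = 2 * f y + (if s y then 2 else 1)"
    "f' (Shadow y) = 2 * f y + (if s y then 1 else 2)" for y
    by (simp_all add: f'_def)
  have s'_simps: "\<not> s' Apex" "\<not> s' (Keep y)" "s' (Shadow y)" for y
    by (simp_all add: s'_def)
  have lab: "\<bar>int (f x) - int (f y)\<bar> \<ge> 2" if "(x, y) \<in> parcs G" for x y
    using assms(3) that wellformed' unfolding split_labeling_def by blast
  have sep: "\<not> near G x y" "s x \<noteq> s y" if "x \<in> pverts G" "y \<in> pverts G" "x \<noteq> y" "f x = f y" for x y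
    using assms(3) that unfolding split_labeling_def by blast+
  have zero: "\<not> s x" if "x \<in> pverts G" "f x = 0" for x
    using assms(3) that unfolding split_labeling_def by blast
  have bound: "f x \<le> k" if "x \<in> pverts G" for x
    using assms(3) that unfolding split_labeling_def by blast
  \<comment> \<open>A gap of 2 doubles to 4, and the offsets reduce it by at most 1.\<close>
  have double: "\<bar>int (2 * a + c) - int (2 * b + d)\<bar> \<ge> 2"
    if "\<bar>int a - int b\<bar> \<ge> 2" "c \<in> {1, 2}" "d \<in> {1, 2}" for a b c d
    using that by auto
  have shadow_ge_2: "f' (Shadow x) \<ge> 2" if "x \<in> pverts G" for x
    using zero[OF that] by (cases "f x = 0") (auto simp: f'_simps)
  have gap: "\<bar>int (f' x) - int (f' y)\<bar> \<ge> 2" if xy: "(x, y) \<in> parcs (mycielski G)" for x y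
  proof -
    from xy show ?thesis
    proof (cases rule: parcs_mycielski_cases)
      case (KK v w)
      then show ?thesis unfolding KK(1,2) f'_simps by (intro double lab) auto
    next
      case (KS v w)
      then show ?thesis unfolding KS(1,2) f'_simps by (intro double lab) auto
    next
      case (SK v w)
      then show ?thesis unfolding SK(1,2) f'_simps by (intro double lab) (auto intro: arc_sym)
    next
      case (SA v)
      then show ?thesis using shadow_ge_2[of v] by (simp add: f'_simps(1))
    next
      case (AS v)
      then show ?thesis using shadow_ge_2[of v] by (simp add: f'_simps(1))
    qed
  qed
  have inj: "x = y" if "x \<in> pverts G" "y \<in> pverts G" "f x = f y" "s x = s y" for x y
    using sep[of x y] that by blast
  have eq_iff: "2 * a + (if p then 2 else 1) = 2 * b + (if q then 1 else 2) \<longleftrightarrow> a = b \<and> p \<noteq> q"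
    for a b :: nat and p q by (cases p; cases q; simp) presburger+
  have eq_iff2: "2 * a + (if p then 2 else 1) = 2 * b + (if q then 2 else 1) \<longleftrightarrow> a = b \<and> p = q"
    for a b :: nat and p q by (cases p; cases q; simp) presburger+
  have eq_iff3: "2 * a + (if p then 1 else 2) = 2 * b + (if q then 1 else 2) \<longleftrightarrow> a = b \<and> p = q"
    for a b :: nat and p q by (cases p; cases q; simp) presburger+
  have KS: "\<not> near (mycielski G) (Keep v) (Shadow w) \<and> \<not> near (mycielski G) (Shadow w) (Keep v)"
    if "v \<in> pverts G" "w \<in> pverts G" "f' (Keep v) = f' (Shadow w)" for v w
  proof -
    have "f v = f w \<and> s v \<noteq> s w" using that(3) unfolding f'_simps eq_iff .
    then have "\<not> near G v w" using sep(1)[of v w] that by auto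
    then show ?thesis using near_mycielski_Keep_Shadow[OF assms(1,2) that(1)] by simp
  qed
  have separate: "\<not> near (mycielski G) x y \<and> s' x \<noteq> s' y"
    if x: "x \<in> pverts (mycielski G)" and y: "y \<in> pverts (mycielski G)" and "x \<noteq> y" "f' x = f' y" for x y
    using x
  proof (cases rule: pverts_mycielski_cases)
    case xK: (Keep v)
    from y show ?thesis
    proof (cases rule: pverts_mycielski_cases)
      case (Keep w)
      then show ?thesis using xK that(3,4) inj[of v w] by (simp add: f'_simps(2) eq_iff2)
    next
      case (Shadow w)
      then show ?thesis using xK that(4) KS[of v w] by (simp add: s'_simps)
    next
      case Apex
      then show ?thesis using xK that(4) by (simp add: f'_simps split: if_splits)
    qed
  next
    case xS: (Shadow v)
    from y show ?thesis
    proof (cases rule: pverts_mycielski_cases)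
      case (Keep w)
      then show ?thesis using xS that(4) KS[of w v] by (simp add: s'_simps)
    next
      case (Shadow w)
      then show ?thesis using xS that(3,4) inj[of v w] by (simp add: f'_simps(3) eq_iff3)
    next
      case Apex
      then show ?thesis using xS that(4) by (simp add: f'_simps split: if_splits)
    qed
  next
    case xA: Apex
    from y show ?thesis
      by (cases rule: pverts_mycielski_cases) (use xA that(3,4) in \<open>auto simp: f'_simps split: if_splits\<close>)
  qed
  have bounds: "f' x \<le> 2 * k + 2 \<and> (f' x = 0 \<longrightarrow> \<not> s' x)" if "x \<in> pverts (mycielski G)" for x
    using that
  proof (cases rule: pverts_mycielski_cases)
    case (Keep y)
    then show ?thesis using bound[of y] by (simp add: f'_simps s'_simps)
  next
    case (Shadow y)
    then show ?thesis using bound[of y] by (simp add: f'_simps)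
  qed (simp add: f'_simps s'_simps)
  have "split_labeling (mycielski G) f' s' (2 * k + 2)"
    unfolding split_labeling_def using gap separate bounds by blast
  then show ?thesis by blast
qed

section \<open>Labeling the second iterate along a conflict-free path\<close>

lemma (in pair_graph) conflict_sym: "conflict G \<pi> a b \<Longrightarrow> conflict G \<pi> b a"
  by (cases a; cases b) (auto dest: arc_sym)

text \<open>The three copies of apexes take labels 0, 1, 2, and the class at position
  \<open>i\<close> of \<open>p\<close> takes \<open>3 + i\<close>; two classes per vertex give the
  stated maximum. Classes joined by an arc are in conflict, so their positions are not
  consecutive.\<close>

lemma split_labeling_mycielski_twice:
  fixes G :: "'a mvertex pair_pre_digraph"
  assumes "pair_graph G" "no_isolated G" "bij_betw \<pi> (pverts G) (pverts G)"
    and nonempty: "pverts G \<noteq> {}"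
    and far: "\<And>v. v \<in> pverts G \<Longrightarrow> \<not> near G v (\<pi> v)"
    and p: "distinct p" "set p = Inl ` pverts G \<union> Inr ` pverts G"
      "successively (\<lambda>a b. \<not> conflict G \<pi> a b) p" "\<exists>v. hd p = Inl v"
  shows "\<exists>f s. split_labeling (mycielski (mycielski G)) f s (2 * card (pverts G) + 2)"
proof -
  interpret pair_graph G by fact
  let ?V = "pverts G"
  \<comment> \<open>The inverse of \<open>\<pi>\<close> locates the upper-level shadows:
    \<open>Shadow (Shadow v)\<close> lies in the class \<open>Inl (\<tau> v)\<close> and
    \<open>Shadow (Keep v)\<close> in \<open>Inr (\<tau> v)\<close>.\<close>
  define \<tau> where "\<tau> = the_inv_into ?V \<pi>"
  have \<tau>: "\<tau> v \<in> ?V" "\<pi> (\<tau> v) = v" if "v \<in> ?V" for v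
    using assms(3) that f_the_inv_into_f_bij_betw[OF assms(3)] the_inv_into_into[of \<pi> ?V v ?V]
    by (auto simp: \<tau>_def bij_betw_def)
  have \<tau>_eq_iff: "\<tau> v = \<tau> w \<longleftrightarrow> v = w" if "v \<in> ?V" "w \<in> ?V" for v w
    using \<tau> that by metis
  have "\<exists>i. i < length p \<and> p ! i = a" if "a \<in> set p" for a
    using that by (simp add: in_set_conv_nth)
  then obtain pos where pos: "\<And>a. a \<in> set p \<Longrightarrow> pos a < length p \<and> p ! pos a = a"
    by metis
  have len: "length p = 2 * card ?V"
  proof -
    have "length p = card (set p)" using p(1) by (simp add: distinct_card)
    also have "\<dots> = card ?V + card ?V"
      unfolding p(2) using pair_finite_verts
      by (subst card_Un_disjoint) (auto simp: card_image)
    finally show ?thesis by simp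
  qed
  have inP: "Inl v \<in> set p" "Inr v \<in> set p" if "v \<in> ?V" for v
    using that p(2) by auto
  have pos_eq_iff: "pos a = pos b \<longleftrightarrow> a = b" if "a \<in> set p" "b \<in> set p" for a b
    using pos that by metis
  have no_step: "pos b \<noteq> Suc (pos a)" if "a \<in> set p" "b \<in> set p" "conflict G \<pi> a b" for a b
    using successively_nth[OF p(3), of "pos a"] pos[OF that(1)] pos[OF that(2)] that(3) by auto
  have gap: "\<bar>int (pos a) - int (pos b)\<bar> \<ge> 2"
    if "a \<in> set p" "b \<in> set p" "conflict G \<pi> a b" "a \<noteq> b" for a b
    using no_step[OF that(1,2,3)] no_step[OF that(2,1) conflict_sym[OF that(3)]]
      pos_eq_iff[OF that(1,2)] that(4) by linarith
  \<comment> \<open>\<open>Shadow Apex\<close> with label 2 is adjacent to every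
    \<open>Keep (Shadow v)\<close>, so label 3 must not go to an \<open>Inr\<close> class.\<close>
  have pos_Inr: "pos (Inr v) \<ge> 1" if "v \<in> ?V" for v
  proof -
    have "p \<noteq> []" using inP[OF that] by auto
    then have "p ! 0 \<noteq> Inr v" using p(4) by (auto simp: hd_conv_nth)
    then show ?thesis using pos[OF inP(2)[OF that]] by (cases "pos (Inr v)") auto
  qed
  define f where "f x = (case x of Base _ \<Rightarrow> 0 | Apex \<Rightarrow> 0
    | Keep y \<Rightarrow> (case y of Keep v \<Rightarrow> 3 + pos (Inl v) | Shadow v \<Rightarrow> 3 + pos (Inr v) | _ \<Rightarrow> 1)
    | Shadow y \<Rightarrow> (case y of Keep v \<Rightarrow> 3 + pos (Inr (\<tau> v)) | Shadow v \<Rightarrow> 3 + pos (Inl (\<tau> v))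
        | _ \<Rightarrow> 2))" for x
  define s where "s x = (case x of Shadow _ \<Rightarrow> True | _ \<Rightarrow> False)" for x :: "'a mvertex"
  have f_simps: "f Apex = 0" "f (Keep Apex) = 1" "f (Shadow Apex) = 2"
    "f (Keep (Keep v)) = 3 + pos (Inl v)" "f (Keep (Shadow v)) = 3 + pos (Inr v)"
    "f (Shadow (Keep v)) = 3 + pos (Inr (\<tau> v))" "f (Shadow (Shadow v)) = 3 + pos (Inl (\<tau> v))" for v
    by (simp_all add: f_def)
  have s_simps: "\<not> s Apex" "\<not> s (Keep y)" "s (Shadow y)" for y
    by (simp_all add: s_def)
  have shift: "\<bar>int (3 + a) - int (3 + b)\<bar> = \<bar>int a - int b\<bar>" for a b by simp
  \<comment> \<open>The five kinds of pairs of classes that arcs of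
    \<open>mycielski (mycielski G)\<close> join, up to symmetry.\<close>
  have arc_gaps: "\<bar>int (pos (Inl v)) - int (pos (Inl w))\<bar> \<ge> 2"
    "\<bar>int (pos (Inl v)) - int (pos (Inr w))\<bar> \<ge> 2"
    "\<bar>int (pos (Inl v)) - int (pos (Inr (\<tau> w)))\<bar> \<ge> 2"
    "\<bar>int (pos (Inl v)) - int (pos (Inl (\<tau> w)))\<bar> \<ge> 2"
    "\<bar>int (pos (Inr v)) - int (pos (Inr (\<tau> w)))\<bar> \<ge> 2"
    if vw: "(v, w) \<in> parcs G" for v w
  proof -
    have V: "v \<in> ?V" "w \<in> ?V" using vw wellformed' by auto
    note \<tau>w = \<tau>[OF V(2)]
    have ne: "v \<noteq> w" "v \<noteq> \<tau> w"
      using vw no_loops' far[OF V(1)] \<tau>w by (auto simp: near_def)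
    show "\<bar>int (pos (Inl v)) - int (pos (Inl w))\<bar> \<ge> 2"
      "\<bar>int (pos (Inl v)) - int (pos (Inr w))\<bar> \<ge> 2"
      "\<bar>int (pos (Inl v)) - int (pos (Inr (\<tau> w)))\<bar> \<ge> 2"
      "\<bar>int (pos (Inl v)) - int (pos (Inl (\<tau> w)))\<bar> \<ge> 2"
      "\<bar>int (pos (Inr v)) - int (pos (Inr (\<tau> w)))\<bar> \<ge> 2"
      by (rule gap; use vw V \<tau>w ne inP in simp)+
  qed
  have sym: "\<bar>int a - int b\<bar> = \<bar>int b - int a\<bar>" for a b by simp
  have gap': "\<bar>int (f x) - int (f y)\<bar> \<ge> 2"
    if xy: "(x, y) \<in> parcs (mycielski (mycielski G))" for x y
  proof -
    have keep_keep: "\<bar>int (f (Keep a)) - int (f (Keep b))\<bar> \<ge> 2"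
      if "(a, b) \<in> parcs (mycielski G)" for a b
      using that
    proof (cases rule: parcs_mycielski_cases)
      case (KK v w)
      show ?thesis unfolding KK(1,2) f_simps shift by (rule arc_gaps[OF KK(3)])
    next
      case (KS v w)
      show ?thesis unfolding KS(1,2) f_simps shift by (rule arc_gaps[OF KS(3)])
    next
      case (SK v w)
      show ?thesis unfolding SK(1,2) f_simps shift by (subst sym) (rule arc_gaps[OF SK(3)])
    qed (simp_all add: f_simps)
    have keep_shadow: "\<bar>int (f (Keep a)) - int (f (Shadow b))\<bar> \<ge> 2"
      if "(a, b) \<in> parcs (mycielski G)" for a b
      using that
    proof (cases rule: parcs_mycielski_cases)
      case (KK v w)
      show ?thesis unfolding KK(1,2) f_simps shift by (rule arc_gaps[OF KK(3)])
    next
      case (KS v w)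
      show ?thesis unfolding KS(1,2) f_simps shift by (rule arc_gaps[OF KS(3)])
    next
      case (SK v w)
      show ?thesis unfolding SK(1,2) f_simps shift by (rule arc_gaps[OF arc_sym[OF SK(3)]])
    next
      case (SA v)
      then show ?thesis using pos_Inr[of v] by (simp add: f_simps)
    qed (simp add: f_simps)
    have shadow: "f (Shadow a) \<ge> 2" if "a \<in> pverts (mycielski G)" for a
      using that by (cases rule: pverts_mycielski_cases) (simp_all add: f_simps)
    from xy show ?thesis
    proof (cases rule: parcs_mycielski_cases)
      case (SK a b)
      then show ?thesis using keep_shadow[of a b] sym by simp
    next
      case (SA a)
      then show ?thesis using shadow[of a] by (simp add: f_simps(1))
    next
      case (AS a)
      then show ?thesis using shadow[of a] by (simp add: f_simps(1))
    qed (simp_all add: keep_keep keep_shadow)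
  qed
  \<comment> \<open>Equal labels mean a common class, whose two members come from some
    \<open>v\<close> and \<open>\<pi> v\<close>.\<close>
  have far_KS: "\<not> near (mycielski G) a b"
    if a: "a \<in> pverts (mycielski G)" and b: "b \<in> pverts (mycielski G)"
      and eq: "f (Keep a) = f (Shadow b)" for a b
    using a
  proof (cases rule: pverts_mycielski_cases)
    case aK: (Keep v)
    from b show ?thesis
    proof (cases rule: pverts_mycielski_cases)
      case (Keep w)
      then show ?thesis using eq aK inP \<tau> by (simp add: f_simps pos_eq_iff)
    next
      case (Shadow w)
      then have "v = \<tau> w" using eq aK inP \<tau> by (simp add: f_simps pos_eq_iff)
      then have "\<pi> v = w" using \<tau> Shadow by simp
      then show ?thesis
        using far[of v] aK Shadow near_mycielski_Keep_Shadow(1)[OF assms(1,2), of v w] by simp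
    qed (use eq aK in \<open>simp add: f_simps\<close>)
  next
    case aS: (Shadow v)
    from b show ?thesis
    proof (cases rule: pverts_mycielski_cases)
      case (Keep w)
      then have "v = \<tau> w" using eq aS inP \<tau> by (simp add: f_simps pos_eq_iff)
      then have "\<pi> v = w" using \<tau> Keep by simp
      then show ?thesis
        using far[of v] aS Keep near_mycielski_Keep_Shadow(2)[OF assms(1,2), of w v] near_sym
        by auto
    next
      case (Shadow w)
      then show ?thesis using eq aS inP \<tau> by (simp add: f_simps pos_eq_iff)
    qed (use eq aS in \<open>simp add: f_simps\<close>)
  next
    case aA: Apex
    from b show ?thesis
      by (cases rule: pverts_mycielski_cases) (use eq aA in \<open>simp_all add: f_simps\<close>)
  qed
  have inj_Keep: "a = b" if a: "a \<in> pverts (mycielski G)" and b: "b \<in> pverts (mycielski G)"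
      and eq: "f (Keep a) = f (Keep b)" for a b
    using a
    by (cases rule: pverts_mycielski_cases; use b in \<open>cases rule: pverts_mycielski_cases\<close>)
      (use eq inP in \<open>auto simp: f_simps pos_eq_iff\<close>)
  have inj_Shadow: "a = b" if a: "a \<in> pverts (mycielski G)" and b: "b \<in> pverts (mycielski G)"
      and eq: "f (Shadow a) = f (Shadow b)" for a b
    using a
    by (cases rule: pverts_mycielski_cases; use b in \<open>cases rule: pverts_mycielski_cases\<close>)
      (use eq inP \<tau> in \<open>auto simp: f_simps pos_eq_iff \<tau>_eq_iff\<close>)
  have pos_f: "f (Keep a) > 0" "f (Shadow a) > 0" if "a \<in> pverts (mycielski G)" for a
    using that by (cases rule: pverts_mycielski_cases; simp add: f_simps)+
  interpret M1: pair_graph "mycielski G" using assms(1) by (rule pair_graph_mycielski)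
  note near_KS = near_mycielski_Keep_Shadow[OF M1.pair_graph_axioms
      no_isolated_mycielski[OF assms(2,1) nonempty]]
  have separate: "\<not> near (mycielski (mycielski G)) x y \<and> s x \<noteq> s y"
    if x: "x \<in> pverts (mycielski (mycielski G))" and y: "y \<in> pverts (mycielski (mycielski G))"
      and ne: "x \<noteq> y" and eq: "f x = f y" for x y
    using x
  proof (cases rule: pverts_mycielski_cases)
    case xK: (Keep a)
    from y show ?thesis
    proof (cases rule: pverts_mycielski_cases)
      case (Keep b)
      then show ?thesis using xK ne eq inj_Keep[of a b] by simp
    next
      case (Shadow b)
      then show ?thesis using xK eq far_KS[of a b] near_KS(1)[of a b] by (simp add: s_simps)
    next
      case Apex
      then show ?thesis using xK eq pos_f[of a] by (simp add: f_simps(1))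
    qed
  next
    case xS: (Shadow a)
    from y show ?thesis
    proof (cases rule: pverts_mycielski_cases)
      case (Keep b)
      then show ?thesis using xS eq far_KS[of b a] near_KS(2)[of b a] by (simp add: s_simps)
    next
      case (Shadow b)
      then show ?thesis using xS ne eq inj_Shadow[of a b] by simp
    next
      case Apex
      then show ?thesis using xS eq pos_f[of a] by (simp add: f_simps(1))
    qed
  next
    case xA: Apex
    from y show ?thesis
      by (cases rule: pverts_mycielski_cases) (use xA ne eq pos_f in \<open>force simp: f_simps(1)\<close>)+
  qed
  have pos_bound: "3 + pos a \<le> 2 * card ?V + 2" if "a \<in> set p" for a
    using pos[OF that] len by simp
  have bounds: "f x \<le> 2 * card ?V + 2 \<and> (f x = 0 \<longrightarrow> \<not> s x)"
    if "x \<in> pverts (mycielski (mycielski G))" for x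
    using that
  proof (cases rule: pverts_mycielski_cases)
    case (Keep a)
    from Keep(2) have "f (Keep a) \<le> 2 * card ?V + 2"
      by (cases rule: pverts_mycielski_cases) (simp_all only: f_simps pos_bound inP)
    then show ?thesis using Keep by (simp add: s_simps)
  next
    case (Shadow a)
    from Shadow(2) have "f (Shadow a) \<le> 2 * card ?V + 2"
      by (cases rule: pverts_mycielski_cases) (simp_all only: f_simps pos_bound inP \<tau>)
    then show ?thesis using Shadow pos_f(2)[of a] by simp
  qed (simp add: f_simps s_simps)
  have "split_labeling (mycielski (mycielski G)) f s (2 * card ?V + 2)"
    unfolding split_labeling_def using gap' separate bounds by blast
  then show ?thesis by blast
qed

section \<open>Optimal labelings of all iterates from the second on\<close>

context mycielski_tower
begin

text \<open>On a finite vertex set the injection \<open>g\<close> is a permutation. Its even cycles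
  are cut, so the map \<open>\<pi>\<close> behind the labeling may differ from
  \<open>g\<close>.\<close>

lemma split_labeling_M_2:
  assumes "inj_on g (pverts G)" "\<And>v. v \<in> pverts G \<Longrightarrow> g v \<in> pverts G \<and> \<not> near G v (g v)"
  shows "\<exists>f s. split_labeling (M 2) f s (2 * card (pverts G) + 2)"
proof -
  let ?H = "base_graph G"
  interpret H: pair_graph ?H by (rule pair_graph_base_graph) unfold_locales
  have bij_g: "bij_betw g (pverts G) (pverts G)"
    using endo_inj_surj[OF pair_finite_verts _ assms(1)] assms by (auto simp: bij_betw_def)
  \<comment> \<open>\<open>permutes\<close> demands the identity outside the vertex set, hence the
    case distinction.\<close>
  define q where "q x = (if x \<in> pverts ?H then map_mvertex g x else x)" for x
  have "q permutes pverts ?H"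
  proof (rule bij_imp_permutes)
    have "inj_on q (pverts ?H)"
      using assms(1) by (auto simp: q_def inj_on_def)
    moreover have "q ` pverts ?H = Base ` g ` pverts G"
      by (auto simp: q_def image_image)
    ultimately show "bij_betw q (pverts ?H) (pverts ?H)"
      using bij_g by (simp add: bij_betw_def)
  qed (simp add: q_def)
  moreover have "\<not> near ?H x (q x)" if "x \<in> pverts ?H" for x
    using that assms(2) by (auto simp: q_def near_base_graph)
  moreover have "symp (\<lambda>x y. \<not> near ?H x y)"
    using H.near_sym by (auto intro: sympI)
  ultimately obtain cs where cs: "distinct (concat cs)" "set (concat cs) = pverts ?H"
    "\<forall>c\<in>set cs. list_all2 (\<lambda>x y. \<not> near ?H x y) c (rotate1 c) \<and> (length c = 2 \<or> odd (length c))"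
    using permutes_odd_cycle_cover[of q "pverts ?H" "\<lambda>x y. \<not> near ?H x y"] H.pair_finite_verts
    by blast
  obtain \<pi> where \<pi>: "\<forall>c\<in>set cs. map \<pi> c = rotate1 c"
    using cycle_lists_permutation[OF cs(1)] by blast
  have far: "\<not> near ?H v (\<pi> v)" if v: "v \<in> set (concat cs)" for v
  proof -
    obtain c where c: "c \<in> set cs" "v \<in> set c" using v by auto
    then have "list_all2 (\<lambda>x y. \<not> near ?H x y) c (map \<pi> c)" using cs(3) \<pi> by simp
    then show ?thesis using c(2) by (auto simp: list_all2_conv_all_nth in_set_conv_nth)
  qed
  have "\<pi> ` set c = set c" if "c \<in> set cs" for c
    using \<pi> that by (metis list.set_map set_rotate1)
  then have "\<pi> ` set (concat cs) = set (concat cs)"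
    unfolding set_concat image_UN by simp
  then have "bij_betw \<pi> (pverts ?H) (pverts ?H)"
    unfolding bij_betw_def cs(2) using finite_surj_inj[OF H.pair_finite_verts] by simp
  moreover have "cs \<noteq> []" using cs(2) nonempty by auto
  from H.conflict_free_path_exists[OF this cs(1), of \<pi>] \<pi> cs(3) far
  obtain p where "distinct p" "set p = Inl ` pverts ?H \<union> Inr ` pverts ?H"
    "successively (\<lambda>a b. \<not> conflict ?H \<pi> a b) p" "\<exists>v. hd p = Inl v"
    unfolding cs(2) by blast
  moreover have "no_isolated ?H" "pverts ?H \<noteq> {}"
    using no_isolated_M[of 0] nonempty by (simp_all add: mycielski_iter_0)
  moreover note far[unfolded cs(2)]
  ultimately have "\<exists>f s. split_labeling (mycielski (mycielski ?H)) f s (2 * card (pverts ?H) + 2)"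
    by (intro split_labeling_mycielski_twice[OF H.pair_graph_axioms])
  moreover have "card (pverts ?H) = card (pverts G)"
    by (simp add: card_image inj_on_def)
  ultimately show ?thesis
    by (simp add: numeral_2_eq_2 mycielski_iter_0 mycielski_iter_Suc)
qed

text \<open>Passing from \<open>k\<close> to \<open>2 * k + 2\<close> doubles \<open>k + 2\<close>,
  so the bound keeps its form from the base case on.\<close>

lemma split_labeling_M:
  assumes "inj_on g (pverts G)" "\<And>v. v \<in> pverts G \<Longrightarrow> g v \<in> pverts G \<and> \<not> near G v (g v)"
    and "t \<ge> 2"
  shows "\<exists>f s. split_labeling (M t) f s (2 ^ (t - 1) * (card (pverts G) + 2) - 2)"
  using assms(3)
proof (induction t rule: dec_induct)
  case base
  then show ?case using split_labeling_M_2[OF assms(1,2)] by simp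
next
  case (step t)
  then obtain f s where
    "split_labeling (M t) f s (2 ^ (t - 1) * (card (pverts G) + 2) - 2)" by blast
  from split_labeling_mycielski[OF pair_graph_M no_isolated_M this]
  have "\<exists>f s. split_labeling (M (Suc t)) f s (2 * (2 ^ (t - 1) * (card (pverts G) + 2) - 2) + 2)"
    by (simp add: mycielski_iter_Suc)
  moreover have "2 * (2 ^ (t - 1) * (card (pverts G) + 2) - 2) + 2 =
      2 ^ (Suc t - 1) * (card (pverts G) + 2) - 2"
  proof -
    \<comment> \<open>The product is at least 2, so no subtraction truncates.\<close>
    have "1 * 2 \<le> 2 ^ (t - 1) * (card (pverts G) + 2)"
      by (rule mult_le_mono) simp_all
    moreover have "(2::nat) ^ (Suc t - 1) = 2 * 2 ^ (t - 1)"
      using step.hyps by (cases t) auto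
    ultimately show ?thesis by (simp only: diff_mult_distrib2 mult.assoc)
  qed
  ultimately show ?case by simp
qed

end

theorem theorem4p6:
  fixes G :: "'a pair_pre_digraph" and n t :: nat
  assumes "pair_graph G"
    and "\<forall>v\<in>pverts G. \<exists>w. (v, w) \<in> parcs G"
    and "card (pverts G) = n"
    and "n \<ge> 2"
    and "t \<ge> 2"
  shows "L21_number (mycielski_iter t G) = 2 ^ (t - 1) * (n + 2) - 2
    \<longleftrightarrow> (\<forall>S\<subseteq>pverts G. card (D2 G S) \<ge> card S)"
proof -
  interpret pair_graph G by fact
  interpret mycielski_tower G
    using assms(2-4) by unfold_locales (auto simp: no_isolated_def)
  obtain s where s: "t = Suc s" "s \<ge> 1" using assms(5) by (cases t) auto
  show ?thesis
  proof
    assume eq: "L21_number (M t) = 2 ^ (t - 1) * (n + 2) - 2"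
    obtain f where "L21_labeling (M t) f" "L21_number (M t) = Max (f ` pverts (M t))"
      using pair_graph.L21_number_labeling[OF pair_graph_M] by blast
    then obtain g where g: "inj_on g (pverts G)"
      "\<forall>v\<in>pverts G. g v \<in> pverts G \<and> \<not> near G v (g v)"
      using tight_labeling_imp_far_injection[of s f] eq s assms(3) by auto
    show "\<forall>S\<subseteq>pverts G. card (D2 G S) \<ge> card S"
    proof (intro allI impI)
      fix S
      assume S: "S \<subseteq> pverts G"
      have "g ` S \<subseteq> D2 G S" using g(2) S unfolding D2_eq by blast
      moreover have "finite (D2 G S)" using pair_finite_verts by (simp add: D2_def)
      moreover have "inj_on g S" using g(1) S by (rule inj_on_subset)
      ultimately show "card S \<le> card (D2 G S)" by (metis card_image card_mono)
    qed
  next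
    assume hall: "\<forall>S\<subseteq>pverts G. card (D2 G S) \<ge> card S"
    have "\<exists>g. inj_on g (pverts G) \<and> (\<forall>v\<in>pverts G. g v \<in> {x \<in> pverts G. \<not> near G v x})"
      by (rule hall_marriage) (use pair_finite_verts hall D2_eq in auto)
    then obtain g where g: "inj_on g (pverts G)"
      "\<And>v. v \<in> pverts G \<Longrightarrow> g v \<in> pverts G \<and> \<not> near G v (g v)" by blast
    then obtain f r where split: "split_labeling (M t) f r (2 ^ (t - 1) * (n + 2) - 2)"
      using split_labeling_M[OF g assms(5)] assms(3) by blast
    have "L21_number (M t) \<le> 2 ^ (t - 1) * (n + 2) - 2"
      using split_labeling_imp_L21_labeling[OF pair_graph_M split] split M_nonempty
      by (intro pair_graph.L21_number_le[OF pair_graph_M]) (auto simp: split_labeling_def)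
    moreover have "2 ^ (t - 1) * (n + 2) - 2 \<le> L21_number (M t)"
      using L21_number_M_ge[of s] s assms(3) by simp
    ultimately show "L21_number (M t) = 2 ^ (t - 1) * (n + 2) - 2" by simp
  qed
qed

end
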